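(* For every integer $p\ge 1$ there is a real constant $C_{p,1}$ (depending only on $p$) such that, for every fixed integer $m\ge 1$, as $n\to\infty$, $$\sum_{k=2}^{n-1} \frac{1}{k\, (\log k)^p} =C_{p,1}-\frac{1}{(p-1)(\log n)^{p-1}} -\frac{1}{2}\frac{1}{n(\log n)^p} -\sum_{k=1}^m \Big(\sum_{r=0}^{2k-1} \frac{d_{p,r,k}}{(\log n)^{r+p}} \Big) \frac{1}{n^{2k}} +O\Big(\frac{1}{n^{2m+1}}\Big),$$ where $d_{p,r,k} := \dfrac{B_{2k}}{2k}\, \dfrac{(p-1+r)!}{(p-1)!}\, S_{r,1,2k-1}$, and where for $p=1$ the second term on the right-hand side, $-\frac{1}{(p-1)(\log n)^{p-1}}$, has to be replaced by $\log(\log n)$.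
   Context: $B_{2k}$ are the Bernoulli numbers. $S_{r,s,t}:=\sum_{s\le i_1<\dots<i_r\le t}\frac{1}{i_1\cdots i_r}$ (sum over integers), which is $0$ for $r\ge 1$ and $t<r+s-1$; $S_{0,s,t}:=1$ if $t\ge s-1$, and $S_{r,s,t}:=0$ if $r<0$. *)

theory Defs
  imports "HOL-Analysis.Analysis" "HOL-Library.Landau_Symbols"
begin

text \<open>Bernoulli numbers via \<open>x / (e\<^sup>x - 1) = (\<Sum>n. B\<^sub>n x\<^sup>n / n!)\<close>, as a quotient of formal power
  series; the convention is \<open>B\<^sub>1 = -1/2\<close>.\<close>

definition bernoulli :: "nat \<Rightarrow> real" where
  "bernoulli n = fact n * fps_nth (fps_X / (fps_exp 1 - 1)) n"

text \<open>The sum \<open>S\<^bsub>r,s,t\<^esub>\<close> of \<open>1 / (i\<^sub>1 \<cdots> i\<^sub>r)\<close> over \<open>s \<le> i\<^sub>1 < \<cdots> < i\<^sub>r \<le> t\<close>. A strictly increasing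
  tuple is represented by the \<open>r\<close>-element set of its entries.\<close>

definition recip_sum :: "int \<Rightarrow> int \<Rightarrow> int \<Rightarrow> real" where
  "recip_sum r s t =
     (if r < 0 then 0
      else \<Sum>I | I \<subseteq> {s..t} \<and> int (card I) = r. 1 / (\<Prod>i\<in>I. real_of_int i))"

lemma recip_sum_0 [simp]: "recip_sum 0 s t = 1"
proof -
  have "I = {}" if "I \<subseteq> {s..t}" "int (card I) = 0" for I
    using that finite_subset[OF that(1)] by simp
  then have "{I. I \<subseteq> {s..t} \<and> int (card I) = 0} = {{}}" by auto
  then show ?thesis by (simp add: recip_sum_def del: of_nat_eq_0_iff)
qed

lemma recip_sum_eq_0: "recip_sum r s t = 0" if "r \<ge> 1" "t < r + s - 1"
proof -
  have "int (card I) < r" if "I \<subseteq> {s..t}" for I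
  proof -
    have "card I \<le> nat (t - s + 1)"
      using card_mono[OF _ that] by simp
    then show ?thesis using \<open>r \<ge> 1\<close> \<open>t < r + s - 1\<close> by linarith
  qed
  then have "{I. I \<subseteq> {s..t} \<and> int (card I) = r} = {}"
    by (blast dest: less_imp_neq)
  then show ?thesis by (simp only: recip_sum_def sum.empty if_cancel)
qed

definition d_coeff :: "nat \<Rightarrow> nat \<Rightarrow> nat \<Rightarrow> real" where
  "d_coeff p r k = bernoulli (2 * k) / real (2 * k) * (fact (p - 1 + r) / fact (p - 1))
                     * recip_sum (int r) 1 (2 * int k - 1)"

end

theory Submission
  imports Defs
begin

text \<open>
  Put \<open>f x = 1 / (x (ln x)\<^sup>p)\<close> and let \<open>F\<close> be its antiderivative \<open>ln (ln x)\<close> or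
  \<open>- 1 / ((p - 1) (ln x)\<^bsup>p-1\<^esup>)\<close>. The claim is the Euler--Maclaurin expansion of \<open>\<Sum> f k\<close>.
  Write \<open>D 0 = F\<close> and \<open>D (j + 1)\<close> for the \<open>j\<close>-th derivative of \<open>f\<close>; the essential property is
  that \<open>D j\<close> is \<open>O(1 / x\<^sup>j)\<close> for \<open>j \<ge> 1\<close>. Each
  differentiation gains a factor \<open>1 / x\<close>, so Taylor expansions with unit step can be truncated. Consider
  \<open>G\<^sub>M x = \<Sum>\<^bsub>i\<le>M\<^esub> B\<^sub>i / i! * D i x\<close>. Taylor's formula on \<open>[x, x + 1]\<close>, with all terms of order
  beyond \<open>M\<close> discarded, gives
  \<open>G\<^sub>M (x + 1) = \<Sum>\<^bsub>s\<le>M\<^esub> D s x * (\<Sum>\<^bsub>i\<le>s\<^esub> B\<^sub>i / (i! (s - i)!)) + O(1 / x\<^bsup>M+1\<^esup>)\<close>.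
  The inner sum is a coefficient of \<open>B(X) e\<^sup>X = B(X) + X\<close> with \<open>B(X) = X / (e\<^sup>X - 1)\<close>
  (\<open>bernoulli_convolution\<close>), so \<open>G\<^sub>M (x + 1) - G\<^sub>M x = f x + O(1 / x\<^bsup>M+1\<^esup>)\<close>
  (\<open>euler_maclaurin_step\<close>).

  Hence \<open>\<Sum>\<^bsub>k<n\<^esub> f k - G\<^sub>M n\<close> has increments \<open>O(1 / n\<^bsup>M+1\<^esup>)\<close> and converges with error
  \<open>O(1 / n\<^sup>M)\<close> (\<open>sequence_limit_rate\<close>). The limit does not depend on \<open>M\<close>, since
  \<open>G\<^sub>M n - G\<^sub>1 n\<close> tends to \<open>0\<close>. This is \<open>euler_maclaurin_asymptotic\<close>.

  It remains to take \<open>M = 2 m + 1\<close>, which gives the required error: \<open>B\<^sub>0 = 1\<close> and \<open>B\<^sub>1 = -1/2\<close> give the first two terms, the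
  other odd Bernoulli numbers vanish, and the derivatives of odd order of \<open>f\<close> give the
  \<open>d\<close>-coefficients. The latter come from the explicit formula for the derivatives
  (\<open>log_iter_deriv_has_derivative\<close>), which rests on the recurrence of the sums \<open>S\<close>
  (\<open>recip_sum_Suc_Suc\<close>).
\<close>

section \<open>Bernoulli numbers\<close>

abbreviation bernoulli_fps :: "real fps" where
  "bernoulli_fps \<equiv> fps_X / (fps_exp 1 - 1)"

lemma bernoulli_fps_times: "bernoulli_fps * (fps_exp 1 - 1) = fps_X"
proof -
  have nz: "fps_exp 1 - 1 \<noteq> (0 :: real fps)"
    using fps_exp_eq_iff[of "1::real" 0] by simp
  have "subdegree (fps_exp 1 - 1 :: real fps) = 1"
    by (rule subdegreeI) auto
  then have "(fps_exp 1 - 1 :: real fps) dvd fps_X"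
    using nz by (simp add: fps_dvd_iff)
  then show ?thesis by simp
qed

lemma bernoulli_over_fact: "bernoulli n / fact n = fps_nth bernoulli_fps n"
  by (simp add: bernoulli_def)

text \<open>Coefficient comparison in \<open>B(X) e\<^sup>X = B(X) + X\<close>, which is the definition of \<open>B(X)\<close> with the
  denominator cleared.\<close>

lemma bernoulli_convolution:
  "(\<Sum>i\<le>s. bernoulli i / fact i / fact (s - i)) =
     bernoulli s / fact s + (if s = 1 then 1 else 0)"
proof -
  have "bernoulli_fps * fps_exp 1 = bernoulli_fps + fps_X"
    using bernoulli_fps_times by (simp add: algebra_simps)
  then have "fps_nth (bernoulli_fps * fps_exp 1) s = fps_nth (bernoulli_fps + fps_X) s"
    by simp
  then show ?thesis
    unfolding bernoulli_over_fact by (simp add: fps_mult_nth atLeast0AtMost)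
qed

lemma bernoulli_0: "bernoulli 0 = 1"
  using bernoulli_convolution[of 1] by simp

text \<open>Replacing \<open>X\<close> by \<open>- X\<close> in \<open>B(X) (e\<^sup>X - 1) = X\<close> and multiplying by \<open>e\<^sup>X\<close> yields
  \<open>B(-X) (e\<^sup>X - 1) = X e\<^sup>X\<close>, so that \<open>B(-X) = B(X) + X\<close>: the odd part of \<open>B(X)\<close> is \<open>- X / 2\<close>.\<close>

lemma bernoulli_odd:
  assumes "odd n" shows "bernoulli n = (if n = 1 then - 1 / 2 else 0)"
proof -
  let ?B' = "bernoulli_fps oo - fps_X"
  have "?B' * (fps_exp (-1) - 1) = (bernoulli_fps * (fps_exp 1 - 1)) oo - fps_X"
    by (subst fps_compose_mult_distrib) (simp_all add: fps_compose_sub_distrib)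
  also have "\<dots> = - fps_X"
    by (simp add: bernoulli_fps_times)
  finally have neg: "?B' * (fps_exp (-1) - 1) = - fps_X" .
  have inv: "fps_exp (-1) * fps_exp 1 = (1 :: real fps)"
    by (simp flip: fps_exp_add_mult)
  have "b * (e - 1) = x * e" if "b * (e' - 1) = - x" "e' * e = 1" for b e e' x :: "real fps"
    using that by algebra
  from this[OF neg inv] have "?B' * (fps_exp 1 - 1) = fps_X * fps_exp 1" .
  then have "(?B' - bernoulli_fps - fps_X) * (fps_exp 1 - 1) = 0"
    using bernoulli_fps_times by (simp add: algebra_simps)
  moreover have "fps_exp 1 - 1 \<noteq> (0 :: real fps)"
    using fps_exp_eq_iff[of "1::real" 0] by simp
  ultimately have "?B' - bernoulli_fps - fps_X = 0"
    by (simp only: mult_eq_0_iff simp_thms)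
  then have "?B' = bernoulli_fps + fps_X"
    by (simp only: diff_diff_eq right_minus_eq)
  then have "fps_nth ?B' n = fps_nth (bernoulli_fps + fps_X) n"
    by simp
  then have "2 * fps_nth bernoulli_fps n = (if n = 1 then -1 else 0)"
    using assms by (simp add: fps_compose_uminus' split: if_splits)
  then show ?thesis
    unfolding bernoulli_def by (auto split: if_splits)
qed

section \<open>The sums of reciprocal products\<close>

text \<open>The recurrence of the elementary symmetric functions of \<open>1, 1/2, \<dots>, 1/j\<close>: a set of
  \<open>r + 1\<close> indices up to \<open>j + 1\<close> either avoids \<open>j + 1\<close>, or arises by inserting \<open>j + 1\<close>
  into a set of \<open>r\<close> indices up to \<open>j\<close>.\<close>

lemma recip_sum_Suc_Suc:
  "recip_sum (int (Suc r)) 1 (int (Suc j)) =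
     recip_sum (int (Suc r)) 1 (int j) + recip_sum (int r) 1 (int j) / real (Suc j)"
proof -
  let ?q = "int (Suc j)"
  let ?T = "\<lambda>r j. {I. I \<subseteq> {1..int j} \<and> int (card I) = int r}"
  let ?w = "\<lambda>I. 1 / (\<Prod>i\<in>I. real_of_int i)"
  have recip_sum_nat: "recip_sum (int r) 1 (int j) = sum ?w (?T r j)" for r j
    by (simp only: recip_sum_def of_nat_less_0_iff if_False)
  have fin: "finite (?T r j)" for r j
    by (rule finite_subset[of _ "Pow {1..int j}"]) auto
  have notin: "?q \<notin> I" "finite I" if "I \<in> ?T r j" for I r
    using that finite_subset[of I "{1..int j}"] by auto
  have split: "?T (Suc r) (Suc j) = ?T (Suc r) j \<union> insert ?q ` ?T r j"
  proof (intro equalityI subsetI)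
    fix I assume I: "I \<in> ?T (Suc r) (Suc j)"
    then have finI: "finite I" using finite_subset[of I "{1..?q}"] by auto
    have card_I: "card I = Suc r"
      using I by (simp only: mem_Collect_eq of_nat_eq_iff)
    show "I \<in> ?T (Suc r) j \<union> insert ?q ` ?T r j"
    proof (cases "?q \<in> I")
      case True
      have "I - {?q} \<subseteq> {1..int j}"
      proof
        fix i assume "i \<in> I - {?q}"
        then have "i \<in> {1..?q}" "i \<noteq> ?q" using I by blast+
        then show "i \<in> {1..int j}" by simp
      qed
      then have "I - {?q} \<in> ?T r j"
        using card_I True by (simp add: card_Diff_singleton)
      then have "insert ?q (I - {?q}) \<in> insert ?q ` ?T r j"
        by (rule imageI)
      then show ?thesis using True by (simp only: insert_Diff Un_iff simp_thms)
    next
      case False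
      have "I \<subseteq> {1..int j}"
      proof
        fix i assume "i \<in> I"
        then have "i \<in> {1..?q}" "i \<noteq> ?q" using I False by blast+
        then show "i \<in> {1..int j}" by simp
      qed
      then show ?thesis using I by simp
    qed
  next
    fix I assume "I \<in> ?T (Suc r) j \<union> insert ?q ` ?T r j"
    then consider "I \<in> ?T (Suc r) j" | J where "J \<in> ?T r j" "I = insert ?q J"
      by (elim UnE imageE)
    then show "I \<in> ?T (Suc r) (Suc j)"
    proof cases
      case 1
      moreover have "{1..int j} \<subseteq> {1..?q}" by simp
      ultimately show ?thesis by blast
    next
      case 2
      moreover have "{1..int j} \<subseteq> {1..?q}" by simp
      ultimately have "I \<subseteq> {1..?q}" by auto
      then show ?thesis using 2 notin[OF 2(1)] by simp
    qed
  qed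
  have "(\<Sum>I\<in>?T (Suc r) (Suc j). ?w I) =
          (\<Sum>I\<in>?T (Suc r) j. ?w I) + (\<Sum>I\<in>insert ?q ` ?T r j. ?w I)"
    unfolding split
  proof (rule sum.union_disjoint)
    show "?T (Suc r) j \<inter> insert ?q ` ?T r j = {}"
      using notin(1)[of _ "Suc r"] by blast
  qed (intro finite_imageI fin)+
  also have "(\<Sum>I\<in>insert ?q ` ?T r j. ?w I) = (\<Sum>I\<in>?T r j. ?w (insert ?q I))"
  proof (subst sum.reindex)
    show "inj_on (insert ?q) (?T r j)"
    proof (rule inj_onI)
      fix I J assume "I \<in> ?T r j" "J \<in> ?T r j" "insert ?q I = insert ?q J"
      then show "I = J"
        using insert_ident[OF notin(1) notin(1)] by blast
    qed
  qed simp
  also have "\<dots> = (\<Sum>I\<in>?T r j. ?w I / real (Suc j))"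
  proof (rule sum.cong[OF refl])
    fix I assume "I \<in> ?T r j"
    from notin[OF this] show "?w (insert ?q I) = ?w I / real (Suc j)"
      by simp
  qed
  finally show ?thesis
    by (simp only: recip_sum_nat sum_divide_distrib)
qed

section \<open>Sequences with small increments\<close>

lemma bigo_real_iff:
  fixes f :: "'a \<Rightarrow> real"
  shows "f \<in> O[F](g) \<longleftrightarrow> (\<exists>c>0. eventually (\<lambda>x. \<bar>f x\<bar> \<le> c * \<bar>g x\<bar>) F)"
  by (simp add: bigo_def)

text \<open>The increments are dominated by those of a null sequence \<open>v n = c' / n\<^sup>M\<close>, so \<open>u\<close> is Cauchy and
  \<open>v n\<close> bounds its distance to the limit. The constant \<open>c' = c 2\<^sup>M\<close> suffices because
  \<open>(n + 1)\<^sup>M - n\<^sup>M \<ge> n\<^bsup>M-1\<^esup>\<close> and \<open>n + 1 \<le> 2 n\<close>.\<close>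

lemma sequence_limit_rate:
  fixes u :: "nat \<Rightarrow> real"
  assumes "M \<ge> 1" and "(\<lambda>n. u (Suc n) - u n) \<in> O(\<lambda>n. 1 / real n ^ Suc M)"
  shows "\<exists>C. (\<lambda>n. u n - C) \<in> O(\<lambda>n. 1 / real n ^ M)"
proof -
  obtain c N where c: "c > 0"
    and u: "\<And>n. n \<ge> N \<Longrightarrow> \<bar>u (Suc n) - u n\<bar> \<le> c * (1 / real n ^ Suc M)"
    using assms(2) unfolding bigo_real_iff eventually_at_top_linorder by auto
  define v where "v = (\<lambda>n. c * 2 ^ M * (1 / real n ^ M))"
  have v_lim: "v \<longlonglongrightarrow> 0"
    unfolding v_def using assms(1)
    by (intro tendsto_mult_right_zero tendsto_divide_0[OF tendsto_const]
         filterlim_at_top_imp_at_infinity filterlim_pow_at_top filterlim_real_sequentially) auto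
  have step: "\<bar>u (Suc n) - u n\<bar> \<le> v n - v (Suc n)" if n: "n \<ge> Suc N" for n
  proof -
    have pos: "real n > 0" using n by simp
    have "real n ^ (M - 1) \<le> real (Suc n) ^ (M - 1)"
      by (intro power_mono) auto
    then have "real n * real n ^ (M - 1) + real n ^ (M - 1) \<le> real (Suc n) * real (Suc n) ^ (M - 1)"
      by (smt (verit) mult_right_mono distrib_right mult_cancel_right1 of_nat_0_le_iff of_nat_Suc
           mult_left_mono)
    then have diff: "real n ^ (M - 1) \<le> real (Suc n) ^ M - real n ^ M"
      using assms(1) by (cases M) auto
    have "1 / real n ^ Suc M = 2 ^ M * (1 / (real n * (2 * real n) ^ M))"
      using pos by (simp add: power_mult_distrib)
    also have "\<dots> \<le> 2 ^ M * (1 / (real n * real (Suc n) ^ M))"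
      using pos n by (intro mult_left_mono divide_left_mono power_mono mult_pos_pos) auto
    also have "1 / (real n * real (Suc n) ^ M) = real n ^ (M - 1) / (real n ^ M * real (Suc n) ^ M)"
      using pos assms(1) by (cases M) (simp_all del: of_nat_Suc)
    also have "\<dots> \<le> (real (Suc n) ^ M - real n ^ M) / (real n ^ M * real (Suc n) ^ M)"
      using diff pos by (intro divide_right_mono) auto
    also have "\<dots> = 1 / real n ^ M - 1 / real (Suc n) ^ M"
      using pos by (simp add: diff_divide_distrib del: of_nat_Suc)
    finally have "c * (1 / real n ^ Suc M) \<le> c * (2 ^ M * (1 / real n ^ M - 1 / real (Suc n) ^ M))"
      using c by (intro mult_left_mono) auto
    then show ?thesis
      using u[of n] n by (simp add: v_def algebra_simps)
  qed
  let ?N = "Suc N"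
  have v_dec: "v n \<ge> v (Suc n)" if "n \<ge> ?N" for n
    using step[OF that] by simp
  have v_nonneg: "v n \<ge> 0" for n
    using c by (simp add: v_def)
  have far: "\<bar>u m - u n\<bar> \<le> v n - v m" if "n \<ge> ?N" "m \<ge> n" for m n
    using that(2)
  proof (induction m rule: dec_induct)
    case (step m)
    then show ?case using \<open>n \<ge> ?N\<close> \<open>\<And>n. n \<ge> ?N \<Longrightarrow> \<bar>u (Suc n) - u n\<bar> \<le> v n - v (Suc n)\<close>[of m]
      by linarith
  qed simp
  have "Cauchy u"
  proof (rule CauchyI')
    fix e :: real assume "e > 0"
    then obtain K where K: "\<And>n. n \<ge> K \<Longrightarrow> \<bar>v n\<bar> < e"
      using LIMSEQ_D[OF v_lim] by auto
    show "\<exists>K. \<forall>m\<ge>K. \<forall>n>m. dist (u m) (u n) < e"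
    proof (intro exI[of _ "max K ?N"] allI impI)
      fix m n assume "m \<ge> max K ?N" "n > m"
      then show "dist (u m) (u n) < e"
        using K[of m] far[of m n] v_nonneg[of n] by (auto simp: dist_real_def)
    qed
  qed
  then obtain C where C: "u \<longlonglongrightarrow> C"
    using Cauchy_convergent convergent_def by blast
  have "\<bar>u n - C\<bar> \<le> v n" if "n \<ge> ?N" for n
  proof (rule tendsto_upperbound)
    show "(\<lambda>m. \<bar>u n - u m\<bar>) \<longlonglongrightarrow> \<bar>u n - C\<bar>"
      by (intro tendsto_intros C)
    show "\<forall>\<^sub>F m in sequentially. \<bar>u n - u m\<bar> \<le> v n"
      using eventually_ge_at_top[of n]
    proof eventually_elim
      case (elim m)
      then show ?case using far[OF that elim] v_nonneg[of m] by linarith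
    qed
  qed simp
  then have "\<forall>\<^sub>F n in sequentially. \<bar>u n - C\<bar> \<le> (c * 2 ^ M) * \<bar>1 / real n ^ M\<bar>"
    unfolding eventually_at_top_linorder v_def by (intro exI[of _ ?N]) auto
  moreover have "c * 2 ^ M > 0" using c by simp
  ultimately show ?thesis
    unfolding bigo_real_iff by blast
qed

section \<open>An asymptotic Euler--Maclaurin formula\<close>

text \<open>The Lagrange remainder is a multiple of \<open>D (M + 1)\<close> at some \<open>t \<in> (x, x + 1)\<close>, whatever \<open>i\<close> is,
  since the order of the expansion decreases with \<open>i\<close>; and \<open>1 / t\<^bsup>M+1\<^esup> \<le> 1 / x\<^bsup>M+1\<^esup>\<close>.\<close>

lemma taylor_step_bigo:
  fixes D :: "nat \<Rightarrow> real \<Rightarrow> real"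
  assumes deriv: "\<And>j x. x \<ge> a \<Longrightarrow> (D j has_real_derivative D (Suc j) x) (at x)"
    and decay: "D (Suc M) \<in> O(\<lambda>x. 1 / x ^ Suc M)"
    and "i \<le> M"
  shows "(\<lambda>x. D i (x + 1) - (\<Sum>j\<le>M - i. D (i + j) x / fact j)) \<in> O(\<lambda>x. 1 / x ^ Suc M)"
proof -
  let ?n = "Suc (M - i)"
  obtain c b where c: "c > 0"
    and cb: "\<And>x. x \<ge> b \<Longrightarrow> \<bar>D (Suc M) x\<bar> \<le> c * \<bar>1 / x ^ Suc M\<bar>"
    using decay unfolding bigo_real_iff eventually_at_top_linorder by auto
  have "\<bar>D i (x + 1) - (\<Sum>j\<le>M - i. D (i + j) x / fact j)\<bar> \<le> c * \<bar>1 / x ^ Suc M\<bar>"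
    if x: "x \<ge> max 1 (max a b)" for x
  proof -
    have "\<exists>t>x. t < x + 1 \<and> D i (x + 1) =
        (\<Sum>j<?n. D (i + j) x / fact j * (x + 1 - x) ^ j) + D (i + ?n) t / fact ?n * (x + 1 - x) ^ ?n"
      using x by (intro Taylor_up[where diff = "\<lambda>j. D (i + j)" and a = x]) (auto intro!: deriv)
    then obtain t where t: "t > x"
      "D i (x + 1) = (\<Sum>j\<le>M - i. D (i + j) x / fact j) + D (Suc M) t / fact ?n"
      using \<open>i \<le> M\<close> by (auto simp: lessThan_Suc_atMost simp del: fact_Suc)
    have "\<bar>D (Suc M) t / fact ?n\<bar> \<le> \<bar>D (Suc M) t\<bar>"
      using fact_ge_1[of ?n, where 'a = real]
      by (simp add: divide_le_eq mult_le_cancel_left1 del: fact_Suc)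
    also have "\<dots> \<le> c * \<bar>1 / t ^ Suc M\<bar>"
      using t x by (intro cb) simp
    also have "\<dots> \<le> c * \<bar>1 / x ^ Suc M\<bar>"
    proof -
      have "x ^ Suc M \<le> t ^ Suc M" "0 < x ^ Suc M" "0 < t ^ Suc M"
        using t x by (auto intro!: power_mono simp del: power_Suc)
      then show ?thesis
        using c by (intro mult_left_mono) (auto intro!: divide_left_mono simp del: power_Suc)
    qed
    finally show ?thesis using t by simp
  qed
  then show ?thesis
    unfolding bigo_real_iff eventually_at_top_linorder using c by blast
qed


lemma bigo_const_mult:
  fixes f :: "'a \<Rightarrow> real"
  shows "f \<in> O[F](g) \<Longrightarrow> (\<lambda>x. c * f x) \<in> O[F](g)"
  by (cases "c = 0") simp_all

text \<open>Up to \<open>O(1 / x\<^bsup>M+1\<^esup>)\<close>, the weights \<open>B\<^sub>i / i!\<close> solve the difference equation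
  \<open>G (x + 1) - G x = D 1 x\<close>: after the Taylor expansion the terms are collected by the total order
  \<open>s = i + j\<close> of differentiation, and \<open>bernoulli_convolution\<close> evaluates the coefficient of each
  \<open>D s x\<close>.\<close>

lemma euler_maclaurin_step:
  fixes D :: "nat \<Rightarrow> real \<Rightarrow> real" and a :: real
  defines "G \<equiv> \<lambda>M x. \<Sum>i\<le>M. bernoulli i / fact i * D i x"
  assumes deriv: "\<And>j x. x \<ge> a \<Longrightarrow> (D j has_real_derivative D (Suc j) x) (at x)"
    and decay: "D (Suc M) \<in> O(\<lambda>x. 1 / x ^ Suc M)" and "M \<ge> 1"
  shows "(\<lambda>x. G M (x + 1) - G M x - D 1 x) \<in> O(\<lambda>x. 1 / x ^ Suc M)"
proof -
  let ?b = "\<lambda>i. bernoulli i / fact i"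
  have conv: "(\<Sum>i\<le>M. ?b i * (\<Sum>j\<le>M - i. D (i + j) x / fact j)) = G M x + D 1 x" for x
  proof -
    have "(\<Sum>i\<le>M. ?b i * (\<Sum>j\<le>M - i. D (i + j) x / fact j)) =
          (\<Sum>(i, j) | i + j \<le> M. ?b i * (D (i + j) x / fact j))"
    proof -
      have "{(i, j). i + j \<le> M} = Sigma {..M} (\<lambda>i. {..M - i})" by auto
      then show ?thesis by (simp add: sum_distrib_left sum.Sigma)
    qed
    also have "\<dots> = (\<Sum>s\<le>M. \<Sum>i\<le>s. ?b i * (D s x / fact (s - i)))"
      by (subst sum.triangle_reindex_eq) simp
    also have "\<dots> = (\<Sum>s\<le>M. D s x * (\<Sum>i\<le>s. ?b i / fact (s - i)))"
      by (simp add: sum_distrib_left algebra_simps)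
    also have "\<dots> = (\<Sum>s\<le>M. ?b s * D s x + (if s = 1 then D s x else 0))"
      unfolding bernoulli_convolution by (intro sum.cong) (auto simp: algebra_simps)
    also have "\<dots> = G M x + D 1 x"
      using \<open>M \<ge> 1\<close> by (simp add: sum.distrib G_def)
    finally show ?thesis .
  qed
  have "(\<lambda>x. \<Sum>i\<le>M. ?b i * (D i (x + 1) - (\<Sum>j\<le>M - i. D (i + j) x / fact j)))
          \<in> O(\<lambda>x. 1 / x ^ Suc M)"
    by (intro big_sum_in_bigo bigo_const_mult taylor_step_bigo[OF deriv decay])
       auto
  moreover have "(\<Sum>i\<le>M. ?b i * (D i (x + 1) - (\<Sum>j\<le>M - i. D (i + j) x / fact j))) =
      G M (x + 1) - G M x - D 1 x" for x
    by (simp only: right_diff_distrib sum_subtractf conv) (simp add: G_def)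
  ultimately show ?thesis by simp
qed

text \<open>The constant is chosen before \<open>M\<close>: it is the one obtained for \<open>M = 1\<close>, and every other \<open>M\<close> leads
  to the same one because the additional terms tend to \<open>0\<close>.\<close>

theorem euler_maclaurin_asymptotic:
  fixes D :: "nat \<Rightarrow> real \<Rightarrow> real" and a :: real and N :: nat
  assumes deriv: "\<And>j x. x \<ge> a \<Longrightarrow> (D j has_real_derivative D (Suc j) x) (at x)"
    and decay: "\<And>j. j \<ge> 1 \<Longrightarrow> D j \<in> O(\<lambda>x. 1 / x ^ j)"
  shows "\<exists>C. \<forall>M\<ge>1. (\<lambda>n. (\<Sum>k=N..<n. D 1 (real k)) -
           (C + (\<Sum>i\<le>M. bernoulli i / fact i * D i (real n)))) \<in> O(\<lambda>n. 1 / real n ^ M)"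
proof -
  define G where "G = (\<lambda>M x. \<Sum>i\<le>M. bernoulli i / fact i * D i x)"
  define u where "u = (\<lambda>M n. (\<Sum>k=N..<n. D 1 (real k)) - G M (real n))"
  have limit: "\<exists>C. (\<lambda>n. u M n - C) \<in> O(\<lambda>n. 1 / real n ^ M)" if "M \<ge> 1" for M
  proof (rule sequence_limit_rate[OF that])
    have "(\<lambda>x. G M (x + 1) - G M x - D 1 x) \<in> O(\<lambda>x. 1 / x ^ Suc M)"
      unfolding G_def using that by (intro euler_maclaurin_step deriv decay) auto
    then have "(\<lambda>n. G M (real n + 1) - G M (real n) - D 1 (real n)) \<in> O(\<lambda>n. 1 / real n ^ Suc M)"
      by (rule landau_o.big.compose[OF _ filterlim_real_sequentially])
    then have "(\<lambda>n. - (G M (real n + 1) - G M (real n) - D 1 (real n))) \<in> O(\<lambda>n. 1 / real n ^ Suc M)"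
      by (simp only: landau_o.big.uminus_in_iff)
    also have "?this \<longleftrightarrow> (\<lambda>n. u M (Suc n) - u M n) \<in> O(\<lambda>n. 1 / real n ^ Suc M)"
    proof (rule landau_o.big.in_cong)
      show "\<forall>\<^sub>F n in sequentially.
              - (G M (real n + 1) - G M (real n) - D 1 (real n)) = u M (Suc n) - u M n"
        using eventually_ge_at_top[of N]
        by eventually_elim (simp add: u_def algebra_simps)
    qed
    finally show "(\<lambda>n. u M (Suc n) - u M n) \<in> O(\<lambda>n. 1 / real n ^ Suc M)" .
  qed
  obtain C where C: "(\<lambda>n. u 1 n - C) \<in> O(\<lambda>n. 1 / real n)"
    using limit[of 1] by auto
  have "(\<lambda>n. u M n - C) \<in> O(\<lambda>n. 1 / real n ^ M)" if M: "M \<ge> 1" for M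
  proof -
    obtain C' where C': "(\<lambda>n. u M n - C') \<in> O(\<lambda>n. 1 / real n ^ M)"
      using limit[OF M] by blast
    have weaken: "(\<lambda>n. 1 / real n ^ j) \<in> O(\<lambda>n. 1 / real n)" if "j \<ge> 1" for j
    proof (rule bigoI[of _ 1])
      show "\<forall>\<^sub>F n in sequentially. norm (1 / real n ^ j) \<le> 1 * norm (1 / real n)"
        using eventually_ge_at_top[of 1]
      proof eventually_elim
        case (elim n)
        then have "real n ^ 1 \<le> real n ^ j"
          using that by (intro power_increasing) auto
        then show ?case using elim by (simp add: divide_simps)
      qed
    qed
    have "(\<lambda>n. \<Sum>i=2..M. bernoulli i / fact i * D i (real n)) \<in> O(\<lambda>n. 1 / real n)"
    proof (intro big_sum_in_bigo bigo_const_mult)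
      fix i assume "i \<in> {2..M}"
      then have "(\<lambda>n. D i (real n)) \<in> O(\<lambda>n. 1 / real n ^ i)"
        by (intro landau_o.big.compose[OF _ filterlim_real_sequentially] decay) auto
      also have "(\<lambda>n. 1 / real n ^ i) \<in> O(\<lambda>n. 1 / real n)"
        using \<open>i \<in> {2..M}\<close> by (intro weaken) auto
      finally show "(\<lambda>n. D i (real n)) \<in> O(\<lambda>n. 1 / real n)" .
    qed
    moreover have "(\<Sum>i=2..M. bernoulli i / fact i * D i (real n)) = u 1 n - u M n" for n
    proof -
      have "{..M} = {..1} \<union> {2..M}" using M by auto
      then show ?thesis
        by (simp add: u_def G_def sum.union_disjoint del: One_nat_def)
    qed
    \<comment> \<open>The difference of the two constants is \<open>O(1 / n)\<close>, hence zero.\<close>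
    ultimately have diff: "(\<lambda>n. u 1 n - u M n) \<in> O(\<lambda>n. 1 / real n)" by simp
    have "(\<lambda>n. (u 1 n - u M n) + (u M n - C') - (u 1 n - C)) \<in> O(\<lambda>n. 1 / real n)"
      by (intro sum_in_bigo diff C landau_o.big_trans[OF C' weaken[OF M]])
    also have "(\<lambda>n. 1 / real n) \<in> o(\<lambda>_. 1)"
      by (intro smalloI_tendsto) (auto intro: lim_1_over_n)
    finally have "(\<lambda>n. C - C') \<in> o(\<lambda>_::nat. 1)" by simp
    then have "C' = C"
      using smalloD_tendsto[of "\<lambda>_. C - C'" sequentially "\<lambda>_. 1"] by (simp add: tendsto_const_iff)
    then show ?thesis using C' by simp
  qed
  then show ?thesis
    unfolding u_def G_def by (intro exI[of _ C]) (simp add: diff_diff_eq algebra_simps)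
qed

section \<open>The derivatives of \<open>1 / (x (ln x)\<^sup>p)\<close>\<close>

definition log_deriv_coeff :: "nat \<Rightarrow> nat \<Rightarrow> nat \<Rightarrow> real" where
  "log_deriv_coeff p j r =
     fact j * (fact (p - 1 + r) / fact (p - 1)) * recip_sum (int r) 1 (int j)"

text \<open>This turns out to be the \<open>j\<close>-th derivative of \<open>1 / (x (ln x)\<^sup>p)\<close>.\<close>

definition log_iter_deriv :: "nat \<Rightarrow> nat \<Rightarrow> real \<Rightarrow> real" where
  "log_iter_deriv p j x =
     (-1) ^ j / x ^ Suc j * (\<Sum>r\<le>j. log_deriv_coeff p j r / ln x ^ (r + p))"

lemma log_deriv_coeff_Suc_0:
  "log_deriv_coeff p (Suc j) 0 = real (Suc j) * log_deriv_coeff p j 0"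
  unfolding log_deriv_coeff_def of_nat_0 recip_sum_0 by simp

text \<open>Differentiating \<open>x\<^bsup>-(j+1)\<^esup> (ln x)\<^bsup>-(r+p)\<^esup>\<close> produces \<open>x\<^bsup>-(j+2)\<^esup>\<close> times
  \<open>-(j + 1) (ln x)\<^bsup>-(r+p)\<^esup> - (r + p) (ln x)\<^bsup>-(r+p+1)\<^esup>\<close>, so the coefficients of consecutive
  derivatives must satisfy this recurrence; the factorials turn it into that of \<open>recip_sum\<close>.\<close>

lemma log_deriv_coeff_Suc_Suc:
  assumes "p \<ge> 1"
  shows "log_deriv_coeff p (Suc j) (Suc r) =
           real (Suc j) * log_deriv_coeff p j (Suc r) + real (r + p) * log_deriv_coeff p j r"
proof -
  obtain q where q: "p = Suc q"
    using assms by (cases p) auto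
  have f: "fact (q + Suc r) = real (r + p) * fact (q + r)" "fact (Suc j) = real (Suc j) * fact j"
    by (simp_all add: q add.commute)
  have "log_deriv_coeff p (Suc j) (Suc r) =
      real (Suc j) * fact j * (real (r + p) * fact (q + r) / fact q) *
        (recip_sum (int (Suc r)) 1 (int j) + recip_sum (int r) 1 (int j) / real (Suc j))"
    unfolding log_deriv_coeff_def recip_sum_Suc_Suc f(2)
    by (simp only: q diff_Suc_1 f(1)[unfolded q])
  also have "\<dots> = real (Suc j) * (fact j * (fact (q + Suc r) / fact q) * recip_sum (int (Suc r)) 1 (int j))
      + real (r + p) * (fact j * (fact (q + r) / fact q) * recip_sum (int r) 1 (int j))"
    unfolding f(1) by (simp add: field_simps del: of_nat_Suc of_nat_add)
  finally show ?thesis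
    by (simp only: log_deriv_coeff_def q diff_Suc_1)
qed

lemma log_deriv_coeff_eq_0: "r > j \<Longrightarrow> log_deriv_coeff p j r = 0"
  unfolding log_deriv_coeff_def by (subst recip_sum_eq_0) simp_all

lemma ln_power_inverse_has_derivative:
  fixes x :: real
  assumes "x > 1"
  shows "((\<lambda>x. c / ln x ^ Suc q) has_real_derivative
           - (real (Suc q) * c / ln x ^ Suc (Suc q)) / x) (at x)"
proof -
  have "((\<lambda>x. ln x ^ Suc q) has_real_derivative real (Suc q) * ln x ^ q / x) (at x)"
    using assms DERIV_power[OF DERIV_ln_divide[of x], of "Suc q"] by simp
  from DERIV_divide[OF DERIV_const this] show ?thesis
    by (rule DERIV_cong) (use assms in \<open>simp_all add: field_simps\<close>)
qed

lemma log_iter_deriv_has_derivative: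
  assumes "p \<ge> 1" "x > 1"
  shows "(log_iter_deriv p j has_real_derivative log_iter_deriv p (Suc j) x) (at x)"
proof -
  let ?a = "log_deriv_coeff p" and ?L = "ln x"
  \<comment> \<open>The coefficient recurrence, summed over \<open>r\<close>: its two terms are the derivatives of the two
    factors.\<close>
  have "(\<Sum>r\<le>Suc j. ?a (Suc j) r / ?L ^ (r + p)) =
          ?a (Suc j) 0 / ?L ^ p + (\<Sum>r\<le>j. ?a (Suc j) (Suc r) / ?L ^ (Suc r + p))"
    by (subst sum.atMost_Suc_shift) simp
  also have "\<dots> = real (Suc j) * (?a j 0 / ?L ^ p + (\<Sum>r\<le>j. ?a j (Suc r) / ?L ^ (Suc r + p)))
                + (\<Sum>r\<le>j. real (r + p) * ?a j r / ?L ^ (Suc r + p))"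
    unfolding log_deriv_coeff_Suc_0 log_deriv_coeff_Suc_Suc[OF assms(1)]
    by (simp add: add_divide_distrib sum.distrib sum_distrib_left ring_distribs
         del: of_nat_Suc of_nat_add power_Suc)
  also have "?a j 0 / ?L ^ p + (\<Sum>r\<le>j. ?a j (Suc r) / ?L ^ (Suc r + p)) =
               (\<Sum>r\<le>Suc j. ?a j r / ?L ^ (r + p))"
    by (simp add: sum.atMost_Suc_shift[of "\<lambda>r. ?a j r / ?L ^ (r + p)"] del: sum.atMost_Suc)
  also have "\<dots> = (\<Sum>r\<le>j. ?a j r / ?L ^ (r + p))"
    by (simp add: log_deriv_coeff_eq_0)
  finally have rec: "(\<Sum>r\<le>Suc j. ?a (Suc j) r / ?L ^ (r + p)) =
      real (Suc j) * (\<Sum>r\<le>j. ?a j r / ?L ^ (r + p)) +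
      (\<Sum>r\<le>j. real (r + p) * ?a j r / ?L ^ (Suc r + p))" .
  have summand: "((\<lambda>x. ?a j r / ln x ^ (r + p)) has_real_derivative
                   - (real (r + p) * ?a j r / ?L ^ (Suc r + p)) / x) (at x)" for r
  proof -
    have "r + p = Suc (r + p - 1)" using assms by simp
    then obtain q where q: "r + p = Suc q" by blast
    show ?thesis
      unfolding add_Suc q by (rule ln_power_inverse_has_derivative[OF assms(2)])
  qed
  have "((\<lambda>x. (-1) ^ j / x ^ Suc j) has_real_derivative
          (-1) ^ Suc j * real (Suc j) / x ^ Suc (Suc j)) (at x)"
    using DERIV_divide[OF DERIV_const DERIV_pow[of "Suc j" x]]
    by (rule DERIV_cong[OF _]) (use assms in \<open>simp_all add: field_simps del: of_nat_Suc\<close>)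
  from DERIV_mult[OF this DERIV_sum[OF summand]]
  have "(log_iter_deriv p j has_real_derivative
      (-1) ^ Suc j * real (Suc j) / x ^ Suc (Suc j) * (\<Sum>r\<le>j. ?a j r / ?L ^ (r + p))
      + (\<Sum>r\<le>j. - (real (r + p) * ?a j r / ?L ^ (Suc r + p)) / x) * ((-1) ^ j / x ^ Suc j)) (at x)"
    unfolding log_iter_deriv_def .
  moreover have "(\<Sum>r\<le>j. - (real (r + p) * ?a j r / ?L ^ (Suc r + p)) / x) =
      - (\<Sum>r\<le>j. real (r + p) * ?a j r / ?L ^ (Suc r + p)) / x"
    by (simp only: sum_divide_distrib flip: sum_negf)
  moreover have "(-1) ^ Suc j * real (Suc j) / x ^ Suc (Suc j) * S + - T / x * ((-1) ^ j / x ^ Suc j)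
      = (-1) ^ Suc j / x ^ Suc (Suc j) * (real (Suc j) * S + T)" for S T
    using assms by (simp add: field_simps del: of_nat_Suc)
  ultimately show ?thesis
    unfolding log_iter_deriv_def rec by (simp only:)
qed

text \<open>For \<open>x \<ge> e\<close> the negative powers of \<open>ln x\<close> are at most \<open>1\<close>.\<close>

lemma log_iter_deriv_bigo: "log_iter_deriv p j \<in> O(\<lambda>x. 1 / x ^ Suc j)"
proof -
  have "(\<lambda>x. log_deriv_coeff p j r / ln x ^ (r + p)) \<in> O(\<lambda>_. 1)" for r
  proof (rule bigoI[of _ "\<bar>log_deriv_coeff p j r\<bar>"])
    show "\<forall>\<^sub>F x in at_top. norm (log_deriv_coeff p j r / ln x ^ (r + p))
            \<le> \<bar>log_deriv_coeff p j r\<bar> * norm (1 :: real)"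
      using eventually_ge_at_top[of "exp 1 :: real"]
    proof eventually_elim
      case (elim x)
      then have "ln x \<ge> 1" by (simp add: ln_ge_iff less_le_trans[OF exp_gt_zero])
      then have "ln x ^ (r + p) \<ge> 1" by (rule one_le_power)
      then show ?case
        by (simp add: divide_le_eq mult_le_cancel_left1)
    qed
  qed
  then have "(\<lambda>x. \<Sum>r\<le>j. log_deriv_coeff p j r / ln x ^ (r + p)) \<in> O(\<lambda>_. 1)"
    by (intro big_sum_in_bigo)
  moreover have "(\<lambda>x::real. (-1) ^ j / x ^ Suc j) \<in> O(\<lambda>x. 1 / x ^ Suc j)"
    by (rule bigoI[of _ 1]) (simp add: norm_divide norm_power)
  ultimately have "(\<lambda>x. (-1) ^ j / x ^ Suc j * (\<Sum>r\<le>j. log_deriv_coeff p j r / ln x ^ (r + p)))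
      \<in> O(\<lambda>x. 1 / x ^ Suc j * 1)"
    by (rule landau_o.big.mult[rotated])
  then show ?thesis
    unfolding log_iter_deriv_def by simp
qed

definition log_antideriv :: "nat \<Rightarrow> real \<Rightarrow> real" where
  "log_antideriv p x =
     (if p = 1 then ln (ln x) else - (1 / ((real p - 1) * ln x ^ (p - 1))))"

lemma log_antideriv_has_derivative:
  assumes "p \<ge> 1" "x > 1"
  shows "(log_antideriv p has_real_derivative 1 / (x * ln x ^ p)) (at x)"
proof (cases "p = 1")
  case True
  have "((\<lambda>x. ln (ln x)) has_real_derivative 1 / (x * ln x)) (at x)"
    using assms DERIV_ln_divide[of "ln x"] DERIV_ln_divide[of x]
      DERIV_chain2[of ln "1 / ln x" ln x "1 / x"] by (simp add: mult.commute)
  then show ?thesis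
    unfolding log_antideriv_def True by simp
next
  case False
  then obtain q where q: "p = Suc (Suc q)"
    using assms by (cases p rule: nat.exhaust; cases "p - 1") auto
  have "log_antideriv p = (\<lambda>x. (- 1 / real (Suc q)) / ln x ^ Suc q)"
    by (simp add: log_antideriv_def q fun_eq_iff)
  then show ?thesis
    using ln_power_inverse_has_derivative[OF assms(2), of "- 1 / real (Suc q)" q]
    by (simp add: q mult.commute del: power_Suc of_nat_Suc)
qed

section \<open>The expansion\<close>

lemma odd_even_split_sum:
  fixes h :: "nat \<Rightarrow> 'a :: comm_monoid_add"
  assumes "\<And>i. odd i \<Longrightarrow> i > 1 \<Longrightarrow> h i = 0"
  shows "(\<Sum>i\<le>2 * m + 1. h i) = h 0 + h 1 + (\<Sum>k=1..m. h (2 * k))"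
proof (induction m)
  case (Suc m)
  have "(\<Sum>i\<le>2 * Suc m + 1. h i) = (\<Sum>i\<le>2 * m + 1. h i) + h (2 * Suc m) + h (2 * Suc m + 1)"
    by simp
  then show ?case
    using assms[of "2 * Suc m + 1"] Suc by (simp add: add.assoc)
qed simp

theorem lemma7p2:
  fixes p :: nat
  assumes "p \<ge> 1"
  shows "\<exists>C::real. \<forall>m::nat. m \<ge> 1 \<longrightarrow>
    (\<lambda>n::nat. (\<Sum>k=2..n-1. 1 / (real k * ln (real k) ^ p))
       - (C
          + (if p = 1 then ln (ln (real n)) else - (1 / ((real p - 1) * ln (real n) ^ (p - 1))))
          - 1 / 2 * (1 / (real n * ln (real n) ^ p))
          - (\<Sum>k=1..m. (\<Sum>r=0..2*k-1. d_coeff p r k / ln (real n) ^ (r + p)) * (1 / real n ^ (2 * k)))))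
    \<in> O[at_top](\<lambda>n. 1 / real n ^ (2 * m + 1))"
proof -
  define D where "D = case_nat (log_antideriv p) (log_iter_deriv p)"
  have D_1: "D 1 x = 1 / (x * ln x ^ p)" for x
    by (simp add: D_def log_iter_deriv_def log_deriv_coeff_def)
  have deriv: "(D j has_real_derivative D (Suc j) x) (at x)" if "x \<ge> 2" for j x
    using log_antideriv_has_derivative[OF assms, of x] D_1[of x]
      log_iter_deriv_has_derivative[OF assms, of x] that
    by (cases j) (auto simp: D_def)
  have decay: "D j \<in> O(\<lambda>x. 1 / x ^ j)" if "j \<ge> 1" for j
    using that log_iter_deriv_bigo by (cases j) (auto simp: D_def simp del: power_Suc)
  obtain C where C: "\<And>M. M \<ge> 1 \<Longrightarrow> (\<lambda>n. (\<Sum>k=2..<n. D 1 (real k)) -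
           (C + (\<Sum>i\<le>M. bernoulli i / fact i * D i (real n)))) \<in> O(\<lambda>n. 1 / real n ^ M)"
    using euler_maclaurin_asymptotic[of 2 D 2, OF deriv decay] by blast
  \<comment> \<open>Here \<open>D (2 * k)\<close> is the derivative of odd order \<open>2 * k - 1\<close>, whence the minus sign; the
    factor \<open>(2 * k - 1)!\<close> in it reduces \<open>B\<^bsub>2k\<^esub> / (2k)!\<close> to \<open>B\<^bsub>2k\<^esub> / (2k)\<close>.\<close>
  have even_term: "bernoulli (2 * k) / fact (2 * k) * D (2 * k) x =
      - ((\<Sum>r=0..2*k-1. d_coeff p r k / ln x ^ (r + p)) * (1 / x ^ (2 * k)))"
    if "k \<ge> 1" for k x
  proof -
    define j where "j = 2 * k - 1"
    have j: "2 * k = Suc j" "odd j" using that by (auto simp: j_def)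
    have "int j = 2 * int k - 1" "2 * k - 1 = j" using j by linarith+
    then have "d_coeff p r k = bernoulli (2 * k) / fact (2 * k) * log_deriv_coeff p j r" for r
      unfolding d_coeff_def log_deriv_coeff_def j(1) by (simp del: of_nat_Suc)
    then have "(\<Sum>r=0..2*k-1. d_coeff p r k / ln x ^ (r + p)) =
        bernoulli (2 * k) / fact (2 * k) * (\<Sum>r\<le>j. log_deriv_coeff p j r / ln x ^ (r + p))"
      unfolding \<open>2 * k - 1 = j\<close> by (simp add: sum_distrib_left atLeast0AtMost)
    moreover have "D (2 * k) x =
        - (1 / x ^ (2 * k)) * (\<Sum>r\<le>j. log_deriv_coeff p j r / ln x ^ (r + p))"
      unfolding j(1) D_def log_iter_deriv_def using j(2) by simp
    ultimately show ?thesis by simp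
  qed
  have expansion: "(\<Sum>i\<le>2 * m + 1. bernoulli i / fact i * D i x) =
      log_antideriv p x - 1 / 2 * (1 / (x * ln x ^ p))
       - (\<Sum>k=1..m. (\<Sum>r=0..2*k-1. d_coeff p r k / ln x ^ (r + p)) * (1 / x ^ (2 * k)))" for m x
  proof -
    have "(\<Sum>i\<le>2 * m + 1. bernoulli i / fact i * D i x) =
        bernoulli 0 / fact 0 * D 0 x + bernoulli 1 / fact 1 * D 1 x
         + (\<Sum>k=1..m. bernoulli (2 * k) / fact (2 * k) * D (2 * k) x)"
      by (rule odd_even_split_sum) (simp add: bernoulli_odd)
    also have "(\<Sum>k=1..m. bernoulli (2 * k) / fact (2 * k) * D (2 * k) x) =
        (\<Sum>k=1..m. - ((\<Sum>r=0..2*k-1. d_coeff p r k / ln x ^ (r + p)) * (1 / x ^ (2 * k))))"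
      by (intro sum.cong even_term) auto
    finally show ?thesis
      unfolding D_1 sum_negf by (simp add: bernoulli_0 bernoulli_odd D_def)
  qed
  show ?thesis
  proof (intro exI[of _ C] allI impI)
    fix m :: nat
    have "{2..n - 1} = {2..<n}" for n :: nat by auto
    then show "(\<lambda>n::nat. (\<Sum>k=2..n-1. 1 / (real k * ln (real k) ^ p))
       - (C
          + (if p = 1 then ln (ln (real n)) else - (1 / ((real p - 1) * ln (real n) ^ (p - 1))))
          - 1 / 2 * (1 / (real n * ln (real n) ^ p))
          - (\<Sum>k=1..m. (\<Sum>r=0..2*k-1. d_coeff p r k / ln (real n) ^ (r + p)) * (1 / real n ^ (2 * k)))))
      \<in> O[at_top](\<lambda>n. 1 / real n ^ (2 * m + 1))"
      using C[of "2 * m + 1"]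
      unfolding expansion D_1 log_antideriv_def by (simp only: add_diff_eq le_add2)
  qed
qed

end
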